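(* We have $$\lim_{n\to \infty}\frac{\#\{1\le k\le n\mid\mathrm{cp}_{3,1,4}(k) \text{ is even}\}}{n} = 1.$$ In particular, for a nonnegative integer $n$, $\mathrm{cp}_{3,1,4}(n)$ is even if some prime $p\equiv 3\pmod 4$ divides $24n+5$ to an odd power.
   Context: For integers $a,b,m\ge1$, an $(a,b,m)$-copartition is a triple of integer partitions $(\gamma,\rho,\sigma)$ such that every part of $\gamma$ is $\ge a$ and $\equiv a \pmod m$, every part of $\sigma$ is $\ge b$ and $\equiv b\pmod m$, and $\rho$ has exactly as many parts as $\sigma$, each part of $\rho$ being equal to $m$ times the number of parts of $\gamma$. Its size is the sum of all parts of $\gamma,\rho,\sigma$, and $\mathrm{cp}_{a,b,m}(n)$ denotes the number of $(a,b,m)$-copartitions of size $n$. *)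

theory Defs
  imports
    Complex_Main
    "HOL-Library.Multiset"
    "HOL-Number_Theory.Number_Theory"
begin

text \<open>
  Partitions are the multisets of their parts; parameters are meant to be positive, so the parts
  of \<open>\<gamma>\<close> and \<open>\<sigma>\<close> are positive automatically. When \<open>\<gamma>\<close> is empty, the parts of \<open>\<rho>\<close> are all
  \<open>m \<cdot> 0 = 0\<close>; such triples do count as copartitions, so \<open>\<rho>\<close> is allowed to have zero parts.
\<close>

definition copartitions ::
    "nat \<Rightarrow> nat \<Rightarrow> nat \<Rightarrow> (nat multiset \<times> nat multiset \<times> nat multiset) set" where
  "copartitions a b m = {(\<gamma>, \<rho>, \<sigma>).
     (\<forall>x\<in>#\<gamma>. a \<le> x \<and> [x = a] (mod m)) \<and>
     (\<forall>x\<in>#\<sigma>. b \<le> x \<and> [x = b] (mod m)) \<and>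
     size \<rho> = size \<sigma> \<and> (\<forall>x\<in>#\<rho>. x = m * size \<gamma>)}"

definition copartition_size :: "nat multiset \<times> nat multiset \<times> nat multiset \<Rightarrow> nat" where
  "copartition_size = (\<lambda>(\<gamma>, \<rho>, \<sigma>). sum_mset \<gamma> + sum_mset \<rho> + sum_mset \<sigma>)"

definition cp :: "nat \<Rightarrow> nat \<Rightarrow> nat \<Rightarrow> nat \<Rightarrow> nat" where
  "cp a b m n = card {c \<in> copartitions a b m. copartition_size c = n}"

lemma size_le_sum_mset:
  fixes M :: "nat multiset"
  assumes "\<forall>x\<in>#M. 1 \<le> x"
  shows "size M \<le> sum_mset M"
  using assms by (induction M) auto

lemma finite_bounded_msets:
  "finite {M :: nat multiset. set_mset M \<subseteq> {..n} \<and> size M \<le> k}"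
proof -
  have "{M :: nat multiset. set_mset M \<subseteq> {..n} \<and> size M \<le> k}
      \<subseteq> mset ` {xs. set xs \<subseteq> {..n} \<and> length xs \<le> k}"
  proof
    fix M :: "nat multiset"
    assume M: "M \<in> {M. set_mset M \<subseteq> {..n} \<and> size M \<le> k}"
    obtain xs where "M = mset xs" using ex_mset[of M] by blast
    with M show "M \<in> mset ` {xs. set xs \<subseteq> {..n} \<and> length xs \<le> k}" by auto
  qed
  then show ?thesis
    by (rule finite_subset) (simp add: finite_lists_length_le)
qed

lemma finite_copartitions:
  assumes "a \<ge> 1" "b \<ge> 1"
  shows "finite {c \<in> copartitions a b m. copartition_size c = n}"
proof -
  let ?B = "{M :: nat multiset. set_mset M \<subseteq> {..n} \<and> size M \<le> n}"
  have elem: "x \<le> sum_mset M" if "x \<in># M" for x :: nat and M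
    using that by (auto dest!: multi_member_split)
  have "{c \<in> copartitions a b m. copartition_size c = n} \<subseteq> ?B \<times> ?B \<times> ?B"
  proof
    fix c assume c: "c \<in> {c \<in> copartitions a b m. copartition_size c = n}"
    obtain g r s where e: "c = (g, r, s)" by (cases c) auto
    from c e have n: "sum_mset g + sum_mset r + sum_mset s = n" and sz: "size r = size s"
      and "\<forall>x\<in>#g. a \<le> x" "\<forall>x\<in>#s. b \<le> x"
      by (auto simp: copartitions_def copartition_size_def)
    then have "\<forall>x\<in>#g. 1 \<le> x" "\<forall>x\<in>#s. 1 \<le> x"
      using assms by force+
    then have "size g \<le> n" "size s \<le> n"
      using n size_le_sum_mset[of g] size_le_sum_mset[of s] by auto
    moreover have "x \<le> n" if "x \<in># g \<or> x \<in># r \<or> x \<in># s" for x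
      using that n elem[of x g] elem[of x r] elem[of x s] by auto
    ultimately show "c \<in> ?B \<times> ?B \<times> ?B" using e sz by auto
  qed
  then show ?thesis
    by (rule finite_subset) (intro finite_cartesian_product finite_bounded_msets)
qed

end

theory Submission
  imports
    Defs
    "HOL-Library.Z2"
    "HOL-Computational_Algebra.Formal_Power_Series"
    "HOL-Analysis.Harmonic_Numbers"
begin

text \<open>
  Let \<open>C(a,b)\<close> be the generating function of \<open>(a,b,m)\<close>-copartitions. Splitting according to whether
  \<open>a\<close> is a part of \<open>\<gamma>\<close> gives \<open>C(a,b) = C(a+m,b) + q\<^sup>a C(a,b+m)\<close>; with the mirror relation
  this yields \<open>(1 - q\<^sup>a) C(a,b) = (1 - q\<^bsup>a+b\<^esup>) C(a+m,b)\<close>. Iterating,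
  \<open>C(3,1) = (q\<^sup>4;q\<^sup>4)\<^sub>\<infinity> / (q;q\<^sup>2)\<^sub>\<infinity>\<close>, which modulo 2 is
  \<open>(q;q)\<^sub>\<infinity> (q\<^sup>4;q\<^sup>4)\<^sub>\<infinity>\<close>. By the pentagonal number theorem, an odd \<open>cp 3 1 4 n\<close> forces
  \<open>24n + 5 = (6j+1)\<^sup>2 + 4(6k+1)\<^sup>2\<close>, a sum of two squares, so primes \<open>p \<equiv> 3 (mod 4)\<close> divide it
  to even powers.

  For a finite set \<open>P\<close> of primes \<open>p \<equiv> 3 (mod 4)\<close>, \<open>p > 3\<close>, the \<open>n\<close>
  for which no \<open>p \<in> P\<close> divides \<open>24n + 5\<close> exactly once have density \<open>\<Prod> (1 - 1/p + 1/p\<^sup>2)\<close>. This product becomes arbitrarily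
  small: start from the non-principal character \<open>\<chi>\<close> modulo 4, for which the partial sums of
  \<open>\<chi>(m)/m\<close> are at most 1, and change its value to 1 at the primes \<open>p \<le> x\<close> with \<open>\<chi>(p) \<noteq> 1\<close>, one
  after the other. Each change multiplies the bound by at most \<open>(p+1)/(p-1)\<close>, and the final sum
  up to \<open>x\<close> is the harmonic number.
\<close>

section \<open>The pentagonal number theorem\<close>

definition pent_sum :: "nat \<Rightarrow> 'a::comm_ring_1 \<Rightarrow> 'a" where
  "pent_sum n q = 1 + (\<Sum>k=1..n. (-1)^k * (q^(k*(3*k-1) div 2) + q^(k*(3*k+1) div 2)))"

text \<open>Shanks' finite form of the pentagonal number theorem: only the term \<open>k = 0\<close> on the left survives
  modulo \<open>q\<^bsup>n+1\<^esup>\<close>.\<close>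

lemma shanks_identity:
  fixes q :: "'a::comm_ring_1"
  shows "(\<Sum>k\<le>n. (-1)^k * (\<Prod>i\<in>{k<..n}. 1 - q^i) * q^(n*k + k*(k+1) div 2)) =
      pent_sum n q"
proof (induction n)
  case 0
  show ?case by (simp add: pent_sum_def)
next
  case (Suc n)
  define A where "A k = (\<Prod>i\<in>{k<..n}. 1 - q^i)" for k
  define e where "e k = k*(k+1) div 2" for k :: nat
  define N where "N = Suc n"
  have e_Suc: "e (Suc k) = e k + Suc k" for k by (simp add: e_def)
  have A_Suc: "A k = A (Suc k) * (1 - q^Suc k)" if "k < n" for k
  proof -
    have "{k<..n} = insert (Suc k) {Suc k<..n}" using that by auto
    then show ?thesis unfolding A_def by (simp add: mult.commute)
  qed
  have A_N: "(\<Prod>i\<in>{k<..N}. 1 - q^i) = A k * (1 - q^N)" if "k \<le> n" for k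
  proof -
    have "{k<..N} = insert N {k<..n}" using that by (auto simp: N_def)
    then show ?thesis unfolding A_def by (simp add: mult.commute N_def)
  qed
  let ?u = "\<lambda>k. (-1)^k * A k * q^(n*k + e k)"
  let ?v = "\<lambda>k. (-1)^k * A k * q^(N*k + e k)"
  let ?w = "\<lambda>k. (-1)^k * A k * q^(N*(k+1) + e k)"
  \<comment> \<open>Passing from \<open>n*k\<close> to \<open>N*k\<close> in the exponent creates
    the factor \<open>q^k - 1\<close>. It vanishes at \<open>k = 0\<close>; otherwise it extends the
    product \<open>A k\<close> downwards by one factor, up to sign, so an index shift leaves a sum
    of \<open>?w\<close>.\<close>
  have "(\<Sum>k\<le>n. ?v k) - (\<Sum>k\<le>n. ?u k) =
      (\<Sum>k\<le>n. (-1)^k * A k * (q^k - 1) * q^(n*k + e k))"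
    by (simp add: sum_subtractf [symmetric] algebra_simps power_add N_def)
  also have "\<dots> =
      (\<Sum>k<n. (-1)^Suc k * A (Suc k) * (q^Suc k - 1) * q^(n*Suc k + e (Suc k)))"
    by (subst sum.atMost_shift) simp
  also have "\<dots> = (\<Sum>k<n. ?w k)"
  proof (rule sum.cong [OF refl])
    fix k assume "k \<in> {..<n}"
    then have "A k = A (Suc k) * (1 - q^Suc k)" by (simp add: A_Suc)
    moreover have "N*(k+1) + e k = n*Suc k + e (Suc k)" by (simp add: N_def e_Suc)
    ultimately have "?w k = (-1)^k * (A (Suc k) * (1 - q^Suc k)) * q^(n*Suc k + e (Suc k))"
      by (simp only:)
    then show "(-1)^Suc k * A (Suc k) * (q^Suc k - 1) * q^(n*Suc k + e (Suc k)) = ?w k"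
      by (simp add: algebra_simps)
  qed
  finally have vu: "(\<Sum>k\<le>n. ?v k) = (\<Sum>k\<le>n. ?u k) + (\<Sum>k<n. ?w k)"
    by (simp add: algebra_simps)
  have "(\<Sum>k\<le>N. (-1)^k * (\<Prod>i\<in>{k<..N}. 1 - q^i) * q^(N*k + e k))
     = (\<Sum>k\<le>n. (-1)^k * (\<Prod>i\<in>{k<..N}. 1 - q^i) * q^(N*k + e k)) + (-1)^N * q^(N*N + e N)"
    by (simp add: N_def)
  also have "(\<Sum>k\<le>n. (-1)^k * (\<Prod>i\<in>{k<..N}. 1 - q^i) * q^(N*k + e k)) =
      (\<Sum>k\<le>n. ?v k - ?w k)"
    by (rule sum.cong) (auto simp: A_N algebra_simps power_add)
  also have "\<dots> = (\<Sum>k\<le>n. ?u k) - ?w n"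
    unfolding sum_subtractf vu by (simp add: lessThan_Suc_atMost [symmetric])
  also have "(\<Sum>k\<le>n. ?u k) = pent_sum n q"
    using Suc.IH by (simp add: A_def e_def)
  \<comment> \<open>The leftover \<open>- ?w n\<close> and the new summand at \<open>k = N\<close>
    are exactly the two pentagonal terms of index \<open>N\<close>.\<close>
  also have "pent_sum n q - ?w n + (-1)^N * q^(N*N + e N) = pent_sum N q"
  proof -
    have "N*(3*N+1) = 2*(N*N) + N*(N+1)" by (simp add: algebra_simps)
    then have 1: "N*N + e N = N*(3*N+1) div 2" unfolding e_def by simp
    have "N*(3*N-1) = 2*(N*(n+1)) + n*(n+1)" by (simp add: N_def algebra_simps)
    then have 2: "N*(n+1) + e n = N*(3*N-1) div 2" unfolding e_def by simp
    show ?thesis unfolding 1 2 by (simp add: pent_sum_def N_def A_def algebra_simps)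
  qed
  finally show ?case by (simp add: N_def e_def)
qed

lemma dvd_prod_minus_pent_sum:
  fixes q :: "'a::comm_ring_1"
  shows "q^Suc n dvd (\<Prod>i=1..n. 1 - q^i) - pent_sum n q"
proof -
  let ?f = "\<lambda>k. (-1)^k * (\<Prod>i\<in>{k<..n}. 1 - q^i) * q^(n*k + k*(k+1) div 2)"
  have "pent_sum n q = ?f 0 + (\<Sum>k=1..n. ?f k)"
    unfolding shanks_identity [symmetric] atMost_atLeast0 by (subst sum.atLeast_Suc_atMost) auto
  also have "?f 0 = (\<Prod>i=1..n. 1 - q^i)"
    by (simp add: atLeastSucAtMost_greaterThanAtMost)
  finally have "(\<Prod>i=1..n. 1 - q^i) - pent_sum n q = - (\<Sum>k=1..n. ?f k)" by simp
  moreover have "q^Suc n dvd ?f k" if "k \<in> {1..n}" for k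
  proof -
    have "n * 1 \<le> n * k" "1 * 2 \<le> k * (k+1)" using that by (intro mult_le_mono; simp)+
    then have "Suc n \<le> n*k + k*(k+1) div 2" by linarith
    then show ?thesis by (intro dvd_mult le_imp_power_dvd)
  qed
  ultimately show ?thesis by (auto intro!: dvd_sum)
qed

text \<open>Completing the square: 24 times the pentagonal number \<open>k*(3*k-1) div 2\<close> or
  \<open>k*(3*k+1) div 2\<close>, plus 1, is the square of \<open>6*k-1\<close> or
  \<open>6*k+1\<close>. An integer \<open>j\<close> covers both families, as \<open>-k\<close> and
  \<open>k\<close>.\<close>

lemma pent_sum_fps_nth_nonzero:
  fixes N :: nat
  assumes "fps_nth (pent_sum n (fps_X ^ t :: 'a::comm_ring_1 fps)) N \<noteq> 0"
  obtains j :: int where "24 * int N + int t = int t * (6*j+1)^2"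
proof -
  have "\<exists>k::nat. N = t * (k*(3*k-1) div 2) \<or> N = t * (k*(3*k+1) div 2)"
  proof (rule ccontr)
    assume *: "\<not> ?thesis"
    have "N \<noteq> 0"
    proof
      assume "N = 0"
      \<comment> \<open>The constant term 1 of \<open>pent_sum\<close> belongs to the pentagonal
        number with \<open>k = 0\<close>.\<close>
      then have "N = t * (0*(3*0-1) div 2)" by simp
      with * show False by blast
    qed
    have zero: "fps_nth ((-1)^k * (fps_X^u + fps_X^v) :: 'a fps) N = 0"
      if "N \<noteq> u" "N \<noteq> v" for k u v
      using that unfolding minus_one_power_iff by simp
    have "fps_nth ((-1)^k * ((fps_X^t)^(k*(3*k-1) div 2) + (fps_X^t)^(k*(3*k+1) div 2)) :: 'a fps) N = 0"
      for k
      unfolding power_mult [symmetric] using * by (intro zero) auto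
    with \<open>N \<noteq> 0\<close> have "fps_nth (pent_sum n (fps_X ^ t :: 'a fps)) N = 0"
      unfolding pent_sum_def fps_add_nth fps_sum_nth
        by (simp only: fps_one_nth sum.neutral_const) simp
    with assms show False ..
  qed
  then obtain k :: nat where "N = t * (k*(3*k-1) div 2) \<or> N = t * (k*(3*k+1) div 2)" ..
  then show ?thesis
  proof
    assume N: "N = t * (k*(3*k-1) div 2)"
    have "even (k*(3*k-1))" by (cases "even k") auto
    then have "int (k*(3*k-1) div 2) * 2 = int (k*(3*k-1))"
      by (metis dvd_div_mult_self of_nat_mult of_nat_numeral)
    also have "\<dots> = int k * (3*int k - 1)" by (cases k) (auto simp: algebra_simps)
    finally have z: "int (k*(3*k-1) div 2) * 2 = int k * (3*int k - 1)" .
    have "24 * int N + int t = 12 * int t * (int (k*(3*k-1) div 2) * 2) + int t"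
      unfolding N of_nat_mult by simp
    also have "\<dots> = int t * (6*(- int k)+1)^2"
      unfolding z by (simp add: algebra_simps power2_eq_square)
    finally show ?thesis using that by blast
  next
    assume N: "N = t * (k*(3*k+1) div 2)"
    have "even (k*(3*k+1))" by (cases "even k") auto
    then have z: "int (k*(3*k+1) div 2) * 2 = int (k*(3*k+1))"
      by (metis dvd_div_mult_self of_nat_mult of_nat_numeral)
    have "24 * int N + int t = 12 * int t * (int (k*(3*k+1) div 2) * 2) + int t"
      unfolding N of_nat_mult by simp
    also have "\<dots> = int t * (6*int k+1)^2"
      unfolding z by (simp add: algebra_simps power2_eq_square)
    finally show ?thesis using that by blast
  qed
qed

section \<open>The generating function of copartitions\<close>

text \<open>The component \<rho> is forced to be \<open>size \<sigma>\<close> copies of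
  \<open>m * size \<gamma>\<close>, so it is dropped and only its sum is kept. This makes the
  symmetry between \<gamma> and \<sigma> visible.\<close>

definition copartition_pairs :: "nat \<Rightarrow> nat \<Rightarrow> nat \<Rightarrow> nat \<Rightarrow> (nat multiset \<times> nat multiset) set" where
  "copartition_pairs a b m n = {(\<gamma>, \<sigma>).
     (\<forall>x\<in>#\<gamma>. a \<le> x \<and> [x = a] (mod m)) \<and> (\<forall>x\<in>#\<sigma>. b \<le> x \<and> [x = b] (mod m)) \<and>
     sum_mset \<gamma> + sum_mset \<sigma> + m * size \<gamma> * size \<sigma> = n}"

lemma bij_betw_copartition_pairs:
  "bij_betw (\<lambda>(\<gamma>, \<rho>, \<sigma>). (\<gamma>, \<sigma>)) {c \<in> copartitions a b m. copartition_size c = n}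
     (copartition_pairs a b m n)"
proof (rule bij_betw_byWitness [where f' = "\<lambda>(\<gamma>, \<sigma>). (\<gamma>, replicate_mset (size \<sigma>) (m * size \<gamma>), \<sigma>)"])
  have rep: "\<rho> = replicate_mset (size \<rho>) x" if "\<forall>y\<in>#\<rho>. y = x"
    for \<rho> and x :: nat
    using that by (induction \<rho>) auto
  have rep': "\<rho> = replicate_mset (size \<sigma>) (m * size \<gamma>)"
    if "(\<gamma>, \<rho>, \<sigma>) \<in> copartitions a b m" for \<gamma> \<rho> \<sigma>
    using that rep[of \<rho> "m * size \<gamma>"] by (auto simp: copartitions_def)
  show "\<forall>c\<in>{c \<in> copartitions a b m. copartition_size c = n}.
      (\<lambda>(\<gamma>, \<sigma>). (\<gamma>, replicate_mset (size \<sigma>) (m * size \<gamma>), \<sigma>)) ((\<lambda>(\<gamma>, \<rho>, \<sigma>). (\<gamma>, \<sigma>)) c) = c"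
    using rep' by auto
  show "(\<lambda>(\<gamma>, \<rho>, \<sigma>). (\<gamma>, \<sigma>)) ` {c \<in> copartitions a b m. copartition_size c = n}
      \<subseteq> copartition_pairs a b m n"
  proof safe
    fix \<gamma> \<rho> \<sigma> assume c: "(\<gamma>, \<rho>, \<sigma>) \<in> copartitions a b m" and n: "n = copartition_size (\<gamma>, \<rho>, \<sigma>)"
    from rep'[OF c] have "sum_mset \<rho> = size \<sigma> * (m * size \<gamma>)" by simp
    with c show "(\<gamma>, \<sigma>) \<in> copartition_pairs a b m (copartition_size (\<gamma>, \<rho>, \<sigma>))"
      by (auto simp: copartitions_def copartition_size_def copartition_pairs_def)
  qed
qed (auto simp: copartitions_def copartition_size_def copartition_pairs_def split: if_splits)

lemma cp_eq_card_pairs: "cp a b m n = card (copartition_pairs a b m n)"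
  unfolding cp_def by (rule bij_betw_same_card [OF bij_betw_copartition_pairs])

lemma finite_copartition_pairs: "a \<ge> 1 \<Longrightarrow> b \<ge> 1 \<Longrightarrow>
    finite (copartition_pairs a b m n)"
  using bij_betw_finite [OF bij_betw_copartition_pairs] finite_copartitions by blast

lemma cp_commute: "cp a b m n = cp b a m n"
proof -
  have "bij_betw prod.swap (copartition_pairs a b m n) (copartition_pairs b a m n)"
    by (rule bij_betw_byWitness [where f' = prod.swap]) (auto simp: copartition_pairs_def algebra_simps)
  then show ?thesis unfolding cp_eq_card_pairs by (rule bij_betw_same_card)
qed

lemma next_in_progression_iff:
  fixes a m x :: nat
  assumes "m \<ge> 1"
  shows "a + m \<le> x \<and> [x = a + m] (mod m) \<longleftrightarrow> (a \<le> x \<and> [x = a] (mod m)) \<and> x \<noteq> a"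
proof -
  have "a + m \<le> x" if "a < x" "[x = a] (mod m)"
  proof -
    from that have "m dvd x - a" by (metis cong_altdef_nat less_imp_le)
    then show ?thesis using that by (auto dest!: dvd_imp_le)
  qed
  then show ?thesis using assms by (auto simp: cong_def)
qed

text \<open>If \<open>a\<close> is a part of \<open>\<gamma>\<close>, it is deleted and the \<open>m\<close> lost from each part of \<open>\<rho>\<close> is added to
  the corresponding part of \<open>\<sigma>\<close>.\<close>

lemma cp_rec:
  assumes "a \<ge> 1" "b \<ge> 1" "m \<ge> 1"
  shows "cp a b m n = cp (a + m) b m n + (if n < a then 0 else cp a (b + m) m (n - a))"
proof -
  let ?P = "copartition_pairs a b m n"
  let ?Q = "{(\<gamma>, \<sigma>) \<in> ?P. a \<in># \<gamma>}"
  have sub: "copartition_pairs (a + m) b m n =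
      {(\<gamma>, \<sigma>) \<in> ?P. a \<notin># \<gamma>}"
    unfolding copartition_pairs_def next_in_progression_iff [OF assms(3)] by auto
  have "?P = copartition_pairs (a + m) b m n \<union> ?Q" unfolding sub by auto
  moreover have "card (copartition_pairs (a + m) b m n \<union> ?Q) =
      card (copartition_pairs (a + m) b m n) + card ?Q"
    using finite_copartition_pairs [OF assms(1,2)]
      by (intro card_Un_disjoint) (auto simp: sub intro: finite_subset)
  moreover have "card ?Q = (if n < a then 0 else card (copartition_pairs a (b + m) m (n - a)))"
  proof (cases "n < a")
    case True
    then have empty: "?Q = {}" by (auto simp: copartition_pairs_def dest!: multi_member_split)
    show ?thesis unfolding empty using True by simp
  next
    case False
    have shift: "m + (x - m) = x" "x - m + m = x" "b \<le> x - m" "[x - m = b] (mod m)"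
      if "b + m \<le> x" "[x = b + m] (mod m)" for x
    proof -
      show "m + (x - m) = x" "x - m + m = x" "b \<le> x - m" using that by auto
      have "[(x - m) + m = b + m] (mod m)" using that by simp
      then show "[x - m = b] (mod m)" by (simp add: cong_def)
    qed
    have sum_shift: "sum_mset (image_mset (\<lambda>x. x + m) \<sigma>) = sum_mset \<sigma> + m * size \<sigma>"
      for \<sigma> :: "nat multiset"
      by (induction \<sigma>) auto
    have id1: "image_mset (\<lambda>x. x - m + m) \<sigma> = \<sigma>"
      if "\<forall>x\<in>#\<sigma>. b + m \<le> x \<and> [x = b + m] (mod m)" for \<sigma>
      using that shift by (intro trans [OF image_mset_cong multiset.map_ident]) auto
    have "bij_betw (\<lambda>(\<gamma>, \<sigma>). (\<gamma> - {#a#}, image_mset (\<lambda>x. x + m) \<sigma>)) ?Q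
        (copartition_pairs a (b + m) m (n - a))"
    proof (rule bij_betw_byWitness [where f' = "\<lambda>(\<gamma>, \<sigma>). (add_mset a \<gamma>, image_mset (\<lambda>x. x - m) \<sigma>)"])
      show "(\<lambda>(\<gamma>, \<sigma>). (\<gamma> - {#a#}, image_mset (\<lambda>x. x + m) \<sigma>)) ` ?Q \<subseteq> copartition_pairs a (b + m) m (n - a)"
      proof safe
        fix \<gamma> \<sigma> assume *: "(\<gamma>, \<sigma>) \<in> ?P" "a \<in># \<gamma>"
        obtain \<gamma>' where g: "\<gamma> = add_mset a \<gamma>'" using *(2)
          by (auto dest: multi_member_split)
        show "(\<gamma> - {#a#}, image_mset (\<lambda>x. x + m) \<sigma>) \<in> copartition_pairs a (b + m) m (n - a)"
          using *(1) unfolding g copartition_pairs_def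
          by (auto simp: sum_shift algebra_simps cong_def)
      qed
      show "(\<lambda>(\<gamma>, \<sigma>). (add_mset a \<gamma>, image_mset (\<lambda>x. x - m) \<sigma>)) ` copartition_pairs a (b + m) m (n - a) \<subseteq> ?Q"
      proof safe
        fix \<gamma> \<sigma> assume *: "(\<gamma>, \<sigma>) \<in> copartition_pairs a (b + m) m (n - a)"
        have "sum_mset \<sigma> =
            sum_mset (image_mset (\<lambda>x. x - m) \<sigma>) + m * size \<sigma>"
          using * sum_shift[of "image_mset (\<lambda>x. x - m) \<sigma>"] id1[of \<sigma>]
          by (auto simp: multiset.map_comp o_def copartition_pairs_def)
        then show "(add_mset a \<gamma>, image_mset (\<lambda>x. x - m) \<sigma>) \<in> ?P"
          using * False unfolding copartition_pairs_def by (auto simp: algebra_simps shift)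
      qed auto
    qed (auto simp: multiset.map_comp o_def id1 copartition_pairs_def)
    then show ?thesis using False by (simp add: bij_betw_same_card)
  qed
  ultimately show ?thesis unfolding cp_eq_card_pairs by simp
qed

section \<open>Functional equations of the generating function\<close>

definition cp_fps :: "nat \<Rightarrow> nat \<Rightarrow> nat \<Rightarrow> 'a::comm_ring_1 fps" where
  "cp_fps a b m = Abs_fps (\<lambda>n. of_nat (cp a b m n))"

lemma cp_fps_commute: "cp_fps a b m = cp_fps b a m"
  by (simp add: cp_fps_def cp_commute[of a])

lemma cp_fps_rec:
  assumes "a \<ge> 1" "b \<ge> 1" "m \<ge> 1"
  shows "cp_fps a b m = cp_fps (a + m) b m + fps_X ^ a * cp_fps a (b + m) m"
  by (rule fps_ext) (simp add: cp_fps_def fps_X_power_mult_nth cp_rec[OF assms])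

text \<open>Removing \<open>a\<close> from \<gamma> and, by symmetry, \<open>b\<close> from \<sigma>
  gives two linear relations between \<open>F\<close>, \<open>G\<close> and \<open>H\<close>;
  subtracting \<open>x\<close> times the second from the first eliminates \<open>H\<close>.\<close>

lemma cp_fps_step:
  assumes "a \<ge> 1" "b \<ge> 1" "m \<ge> 1"
  shows "(1 - fps_X ^ a) * cp_fps a b m = (1 - fps_X ^ (a + b)) * cp_fps (a + m) b m"
proof -
  define x y :: "'a fps" where "x = fps_X ^ a" and "y = fps_X ^ b"
  define F G H :: "'a fps" where "F = cp_fps a b m" and "G = cp_fps (a + m) b m"
    and "H = cp_fps a (b + m) m"
  have 1: "F = G + x * H" unfolding F_def G_def H_def x_def by (rule cp_fps_rec [OF assms])
  have 2: "F = H + y * G" unfolding F_def G_def H_def y_def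
    using cp_fps_rec[of b a m] assms by (simp add: cp_fps_commute[of a] cp_fps_commute[of "a+m"])
  have "(1 - x) * F = (G + x * H) - x * (H + y * G)" using 1 2 by (simp add: algebra_simps)
  then show ?thesis unfolding F_def G_def H_def x_def y_def by (simp add: algebra_simps power_add)
qed

text \<open>Stopping after \<open>K\<close> steps avoids infinite products: a suitable
  \<open>K\<close> later makes all remaining factors 1 up to the required order.\<close>

lemma cp_fps_steps:
  assumes "a \<ge> 1" "b \<ge> 1" "m \<ge> 1"
  shows "(\<Prod>i<K. 1 - fps_X ^ (a + m*i)) * cp_fps a b m =
      (\<Prod>i<K. 1 - fps_X ^ (a + b + m*i)) * cp_fps (a + m*K) b m"
proof (induction K)
  case (Suc K)
  have "(\<Prod>i<Suc K. 1 - fps_X ^ (a + m*i)) * cp_fps a b m =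
     (1 - fps_X ^ (a + m*K)) * ((\<Prod>i<K. 1 - fps_X ^ (a + m*i)) * cp_fps a b m :: 'a fps)" by simp
  also have "\<dots> =
      (\<Prod>i<K. 1 - fps_X ^ (a + b + m*i)) * ((1 - fps_X ^ (a + m*K)) * cp_fps (a + m*K) b m)"
    unfolding Suc by simp
  also have "(1 - fps_X ^ (a + m*K)) * cp_fps (a + m*K) b m =
      ((1 - fps_X ^ (a + m*K + b)) * cp_fps (a + m*K + m) b m :: 'a fps)"
    using assms by (intro cp_fps_step) auto
  finally show ?case by (simp add: algebra_simps)
qed simp

text \<open>Any part of \<gamma> or \<sigma> would already exceed \<open>n\<close>, so only the
  empty pair can occur.\<close>

lemma cp_small:
  assumes "n < a" "n < b"
  shows "cp a b m n = of_bool (n = 0)"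
proof -
  have "copartition_pairs a b m n = (if n = 0 then {({#}, {#})} else {})"
  proof -
    have "\<gamma> = {#} \<and> \<sigma> = {#}"
      if "(\<gamma>, \<sigma>) \<in> copartition_pairs a b m n" for \<gamma> \<sigma>
      using that assms by (cases \<gamma>; cases \<sigma>) (auto simp: copartition_pairs_def)
    then have "copartition_pairs a b m n \<subseteq> {({#}, {#})}" by auto
    moreover have "({#}, {#}) \<in> copartition_pairs a b m n \<longleftrightarrow> n = 0"
      by (auto simp: copartition_pairs_def)
    ultimately show ?thesis by auto
  qed
  then show ?thesis by (simp add: cp_eq_card_pairs)
qed

lemma dvd_cp_fps_minus_one:
  assumes "N \<le> a" "N \<le> b"
  shows "fps_X ^ N dvd cp_fps a b m - (1 :: 'a::comm_ring_1 fps)"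
proof -
  have "cp_fps a b m - 1 = (fps_X ^ N * fps_shift N (cp_fps a b m - 1) :: 'a fps)"
    by (rule fps_ext) (use assms in \<open>auto simp: fps_X_power_mult_nth cp_fps_def cp_small\<close>)
  then show ?thesis by (metis dvd_triv_left)
qed

section \<open>Reduction modulo 2\<close>

text \<open>Each extra factor has exponent above \<open>n\<close> and is therefore 1 modulo
  \<open>q ^ Suc n\<close>.\<close>

lemma dvd_prod_one_minus_power_tail:
  fixes q :: "'a::comm_ring_1"
  shows "q ^ Suc n dvd (\<Prod>i=1..n+k. 1 - q^i) - (\<Prod>i=1..n. 1 - q^i)"
proof (induction k)
  case (Suc k)
  let ?P = "\<lambda>n. \<Prod>i=1..n. 1 - q^i"
  have "?P (n + Suc k) - ?P n = (?P (n + k) - ?P n) - ?P (n + k) * q^(Suc n + k)"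
    by (simp add: algebra_simps)
  moreover have "q ^ Suc n dvd ?P (n + k) * q^(Suc n + k)"
    by (intro dvd_mult le_imp_power_dvd) simp
  ultimately show ?case using Suc by (metis dvd_diff)
qed simp

lemma prod_one_minus_odd_powers:
  fixes q :: "'a::comm_ring_1"
  shows "(\<Prod>j<n. 1 - q^(2*j+1)) * (\<Prod>i=1..n. 1 - q^(2*i)) = (\<Prod>i=1..2*n. 1 - q^i)"
  by (induction n) (simp_all add: algebra_simps)

lemma one_minus_square_bit_fps: "(1 - x)^2 = 1 - x^2" for x :: "bit fps"
proof -
  have two: "(2 :: bit fps) = 0"
    by (simp add: numeral_fps_const)
  have "(1 - x)^2 = 1 - x^2 + 2 * (x^2 - x)" by (simp add: algebra_simps power2_eq_square)
  then show ?thesis by (simp add: two)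
qed

text \<open>Modulo 2, \<open>(q;q\<^sup>2)\<^sub>\<infinity> (q;q)\<^sub>\<infinity> = (q;q)\<^sub>\<infinity>\<^sup>2 / (q\<^sup>2;q\<^sup>2)\<^sub>\<infinity>\<close> equals 1.\<close>

lemma dvd_euler_odd_even_minus_one:
  "fps_X ^ Suc n dvd (\<Prod>j<n. 1 - fps_X^(2*j+1)) * (\<Prod>i=1..n. 1 - fps_X^i) - (1 :: bit fps)"
proof -
  define D E :: "bit fps" where "D = (\<Prod>j<n. 1 - fps_X^(2*j+1))"
    and "E = (\<Prod>i=1..n. 1 - fps_X^i)"
  have "(\<Prod>i=1..n. 1 - fps_X^(2*i)) = E^2"
    unfolding E_def prod_power_distrib one_minus_square_bit_fps
    by (simp add: power_mult [symmetric] mult.commute)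
  then have "(\<Prod>i=1..n+n. 1 - fps_X^i) = D * E^2"
    using prod_one_minus_odd_powers[where q = "fps_X :: bit fps" and n = n]
    unfolding D_def by (simp add: mult_2)
  \<comment> \<open>The product up to \<open>2n\<close> is \<open>D * E^2\<close>, yet it agrees
    with \<open>E\<close> to this order because the factors beyond \<open>n\<close> do not
    matter.\<close>
  then have "fps_X ^ Suc n dvd D * E^2 - E"
    using dvd_prod_one_minus_power_tail[where q = "fps_X :: bit fps" and n = n and k = n]
    unfolding E_def by simp
  also have "D * E^2 - E = (D * E - 1) * E" by (simp add: algebra_simps power2_eq_square)
  finally have dvd: "fps_X ^ Suc n dvd (D * E - 1) * E" .
  \<comment> \<open>Constant term 1 makes \<open>E\<close> a unit, so it can be cancelled.\<close>
  have "fps_nth E 0 = 1" unfolding E_def by (induction n) simp_all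
  then have "E dvd 1" by simp
  with dvd show ?thesis unfolding D_def E_def by (subst (asm) dvd_mult_unit_iff)
qed

text \<open>Everything is computed modulo \<open>fps_X ^ L\<close>. There
  \<open>D * C = P4 * R\<close> with \<open>R\<close> congruent to 1, and \<open>E\<close> inverts
  \<open>D\<close>, so \<open>C\<close> is congruent to \<open>E * P4\<close>; each factor is then
  replaced by its pentagonal sum.\<close>

lemma cp_fps_3_1_4_mod_2:
  assumes "K \<ge> 1"
  shows "fps_X ^ Suc (2*K) dvd
    cp_fps 3 1 4 - pent_sum (2*K) fps_X * pent_sum K (fps_X ^ 4 :: bit fps)"
proof -
  define L where "L = Suc (2*K)"
  define C :: "bit fps" where "C = cp_fps 3 1 4"
  define D E :: "bit fps" where "D = (\<Prod>j<2*K. 1 - fps_X^(2*j+1))"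
    and "E = (\<Prod>i=1..2*K. 1 - fps_X^i)"
  define P1 P3 P4 :: "bit fps" where "P1 = (\<Prod>i<K. 1 - fps_X^(1+4*i))"
    and "P3 = (\<Prod>i<K. 1 - fps_X^(3+4*i))" and "P4 = (\<Prod>i=1..K. 1 - (fps_X^4)^i)"
  define R :: "bit fps" where "R = P1 * cp_fps 1 (3 + 4*K) 4"
  have D: "D = P1 * P3"
    unfolding D_def P1_def P3_def
      by (induction K) (simp_all add: algebra_simps power_add power3_eq_cube)
  have "P3 * C = (\<Prod>i<K. 1 - fps_X^(3+1+4*i)) * cp_fps (3 + 4*K) 1 4"
    unfolding P3_def C_def by (rule cp_fps_steps) auto
  also have "(\<Prod>i<K. 1 - fps_X^(3+1+4*i)) = P4"
    unfolding P4_def power_mult [symmetric]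
    by (rule prod.reindex_bij_witness [where i = "\<lambda>i. i - 1" and j = Suc]) auto
  finally have "P3 * C = P4 * cp_fps 1 (3 + 4*K) 4" by (simp only: cp_fps_commute[of 1])
  then have DC: "D * C = P4 * R" unfolding D R_def by (simp add: algebra_simps)
  \<comment> \<open>Now the argument 1 is advanced \<open>K\<close> times. This absorbs
    \<open>P1\<close> and leaves factors with exponents at least \<open>4*K+4\<close> and a
    generating function whose two parameters are at least \<open>L\<close>.\<close>
  have "fps_X ^ L dvd R - 1"
  proof -
    let ?c = "cp_fps (1 + 4*K) (3 + 4*K) 4 :: bit fps"
    let ?P = "\<lambda>K'. \<Prod>i<K'. 1 - fps_X^(1+(3+4*K)+4*i) :: bit fps"
    have "fps_X ^ L dvd ?P K' - 1" for K'
    proof (induction K')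
      case (Suc K')
      have "?P (Suc K') - 1 = (?P K' - 1) - ?P K' * fps_X^(1+(3+4*K)+4*K')"
        by (simp add: algebra_simps)
      moreover have "fps_X ^ L dvd ?P K' * fps_X^(1+(3+4*K)+4*K')"
        by (intro dvd_mult le_imp_power_dvd) (simp add: L_def)
      ultimately show ?case using Suc by (metis dvd_diff)
    qed simp
    moreover have "fps_X ^ L dvd ?c - 1"
      by (rule dvd_cp_fps_minus_one) (use assms in \<open>auto simp: L_def\<close>)
    ultimately have "fps_X ^ L dvd (?P K - 1) * ?c + (?c - 1)" by (intro dvd_add dvd_mult2)
    moreover have "R = ?P K * ?c"
      unfolding R_def P1_def by (rule cp_fps_steps) auto
    ultimately show ?thesis
      by (simp only: left_diff_distrib mult_1_left add_diff_eq diff_add_cancel)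
  qed
  then obtain b where "R - 1 = fps_X ^ L * b" by (elim dvdE)
  then have R: "R = 1 + fps_X ^ L * b" by (simp add: algebra_simps)
  have "fps_X ^ L dvd D * E - 1"
    unfolding D_def E_def L_def by (rule dvd_euler_odd_even_minus_one)
  then obtain a where "D * E - 1 = fps_X ^ L * a" by (elim dvdE)
  then have DE: "D * E = 1 + fps_X ^ L * a" by (simp add: algebra_simps)
  \<comment> \<open>Evaluating \<open>C * D * E\<close> in two ways isolates
    \<open>C\<close>.\<close>
  have "C * (D * E) = C + fps_X ^ L * (C * a)" unfolding DE by (simp add: algebra_simps)
  moreover have "C * (D * E) = E * (D * C)" by (simp add: algebra_simps)
  then have "C * (D * E) = E * P4 + fps_X ^ L * (E * P4 * b)"
    unfolding DC R by (simp add: algebra_simps)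
  ultimately have C: "C = E * P4 + fps_X ^ L * (E * P4 * b - C * a)"
    by (simp add: algebra_simps)
  have "fps_X ^ L dvd E - pent_sum (2*K) fps_X"
    unfolding E_def L_def by (rule dvd_prod_minus_pent_sum)
  then obtain c where "E - pent_sum (2*K) fps_X = fps_X ^ L * c" by (elim dvdE)
  then have E: "E = pent_sum (2*K) fps_X + fps_X ^ L * c" by (simp add: algebra_simps)
  have "(fps_X ^ 4) ^ Suc K dvd P4 - pent_sum K (fps_X ^ 4)"
    unfolding P4_def by (rule dvd_prod_minus_pent_sum)
  moreover have "fps_X ^ L dvd ((fps_X ^ 4) ^ Suc K :: bit fps)"
    unfolding power_mult [symmetric] by (rule le_imp_power_dvd) (simp add: L_def)
  ultimately have "fps_X ^ L dvd P4 - pent_sum K (fps_X ^ 4)" by (rule dvd_trans [rotated])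
  then obtain d where "P4 - pent_sum K (fps_X ^ 4) = fps_X ^ L * d" by (elim dvdE)
  then have P4: "P4 = pent_sum K (fps_X ^ 4) + fps_X ^ L * d" by (simp add: algebra_simps)
  have "E * P4 = pent_sum (2*K) fps_X * P4 + fps_X ^ L * (c * P4)"
    unfolding E by (simp add: algebra_simps)
  also have "pent_sum (2*K) fps_X * P4 =
      pent_sum (2*K) fps_X * pent_sum K (fps_X ^ 4) + fps_X ^ L * (pent_sum (2*K) fps_X * d)"
    unfolding P4 by (simp add: algebra_simps)
  finally have "E * P4 = pent_sum (2*K) fps_X * pent_sum K (fps_X ^ 4) +
      fps_X ^ L * (c * P4 + pent_sum (2*K) fps_X * d)"
    by (simp add: algebra_simps)
  then have "C - pent_sum (2*K) fps_X * pent_sum K (fps_X ^ 4) =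
     fps_X ^ L * (c * P4 + pent_sum (2*K) fps_X * d + (E * P4 * b - C * a))"
    using C by (simp add: algebra_simps)
  then show ?thesis unfolding C_def L_def by (metis dvd_triv_left)
qed

text \<open>A nonzero coefficient of the product needs an \<open>i\<close> at which both pentagonal
  sums have nonzero coefficients; adding the two completed squares gives
  \<open>24 * n + 5\<close>.\<close>

lemma odd_cp_3_1_4_imp_sum_of_squares:
  assumes "odd (cp 3 1 4 n)"
  obtains x y :: int where "int (24 * n + 5) = x^2 + y^2"
proof -
  let ?P = "pent_sum (2 * Suc n) fps_X :: bit fps" and ?Q = "pent_sum (Suc n) (fps_X ^ 4) :: bit fps"
  \<comment> \<open>Taking \<open>K = Suc n\<close> puts the error beyond the coefficient of index
    \<open>n\<close>.\<close>
  obtain h where "cp_fps 3 1 4 - ?P * ?Q = fps_X ^ Suc (2 * Suc n) * h"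
    using cp_fps_3_1_4_mod_2[of "Suc n"] by (auto elim: dvdE)
  then have "fps_nth (cp_fps 3 1 4 - ?P * ?Q) n = 0"
    by (simp only: fps_X_power_mult_nth) simp
  then have "fps_nth (?P * ?Q) n = of_nat (cp 3 1 4 n)"
    by (simp only: fps_sub_nth cp_fps_def fps_nth_Abs_fps eq_iff_diff_eq_0[of "of_nat _"]) (metis eq_iff_diff_eq_0)
  also have "\<dots> \<noteq> 0" using assms by (metis dvd_0_right even_of_nat)
  finally have "(\<Sum>i=0..n. fps_nth ?P i * fps_nth ?Q (n - i)) \<noteq> 0"
    by (simp only: fps_mult_nth not_False_eq_True)
  then obtain i where i: "i \<le> n" "fps_nth ?P i \<noteq> 0" "fps_nth ?Q (n - i) \<noteq> 0"
    by (metis (no_types, lifting) atLeastAtMost_iff mult_zero_left mult_zero_right sum.neutral)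
  obtain j where j: "24 * int i + int 1 = int 1 * (6*j+1)^2"
    using i(2) pent_sum_fps_nth_nonzero[of "2 * Suc n" 1 i, where ?'a = bit] by auto
  obtain k where k: "24 * int (n - i) + int 4 = int 4 * (6*k+1)^2"
    using i(3) pent_sum_fps_nth_nonzero by blast
  have "int (24 * n + 5) = (6*j+1)^2 + (2*(6*k+1))^2"
    using j k i(1) unfolding power_mult_distrib by (simp add: of_nat_diff)
  then show ?thesis using that by blast
qed

section \<open>Sums of two squares\<close>

text \<open>For \<open>p = 4*t+3\<close> the exponent \<open>(p-1)/2 = 2*t+1\<close> is odd. If
  \<open>p\<close> did not divide \<open>x\<close>, it would not divide \<open>y\<close> either;
  raising \<open>x^2 = -y^2\<close> to this power and applying Fermat would give
  \<open>1 = -1\<close> modulo \<open>p\<close>.\<close>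

lemma prime_3_mod_4_dvd_sum_of_squares:
  fixes p :: nat and x y :: int
  assumes "prime p" "[p = 3] (mod 4)" "int p dvd x^2 + y^2"
  shows "int p dvd x \<and> int p dvd y"
proof -
  define t where "t = p div 4"
  have p: "p = 4 * t + 3" using assms(2) unfolding t_def cong_def by presburger
  have pi: "prime (int p)" using assms(1) by simp
  have aux: "int p dvd x" if d: "int p dvd x^2 + y^2" for x y :: int
  proof (rule ccontr)
    assume nx: "\<not> int p dvd x"
    have ny: "\<not> int p dvd y"
    proof
      assume "int p dvd y"
      then have "int p dvd y^2" by (simp add: power2_eq_square)
      then have "int p dvd x^2" using d by (simp add: dvd_add_left_iff)
      then show False using nx pi prime_dvd_power by blast
    qed
    have fermat: "[z ^ (4*t+2) = 1] (mod int p)" if "\<not> int p dvd z" for z :: int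
    proof -
      have "coprime z (int p)" using prime_imp_coprime[OF pi that] by (simp add: coprime_commute)
      moreover have "residues (int p)" using prime_gt_1_nat[OF assms(1)] by unfold_locales simp
      ultimately have "[z ^ totient p = 1] (mod int p)" using residues.euler_theorem[of "int p" z]
        by simp
      then show ?thesis using assms(1) p by (simp add: totient_prime)
    qed
    have "[x^2 = - (y^2)] (mod int p)" using d by (simp add: cong_iff_dvd_diff)
    then have "[(x^2)^(2*t+1) = (- (y^2))^(2*t+1)] (mod int p)" by (rule cong_pow)
    moreover have "2 * (2*t+1) = 4*t+2" by simp
    ultimately have "[x^(4*t+2) = - (y^(4*t+2))] (mod int p)"
      by (simp only: power_minus_odd odd_two_times_div_two_succ even_mult_iff even_plus_one_iff
          dvd_triv_left not_not power_mult [symmetric])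
    moreover note fermat[OF nx] fermat[OF ny]
    ultimately have "[1 = - 1] (mod int p)"
      by (metis cong_minus_minus_iff cong_sym cong_trans)
    then have "int p dvd 2" by (simp add: cong_iff_dvd_diff)
    then have "int p \<le> 2" by (intro zdvd_imp_le) auto
    then show False using p by simp
  qed
  show ?thesis using aux[of x y] aux[of y x] assms(3) by (simp add: add.commute)
qed

text \<open>Descent: if \<open>p\<close> divides \<open>N\<close>, it divides both \<open>x\<close>
  and \<open>y\<close>, so \<open>N\<close> divided by \<open>p^2\<close> is a smaller sum of two
  squares.\<close>

lemma even_multiplicity_sum_of_squares:
  fixes p N :: nat and x y :: int
  assumes "prime p" "[p = 3] (mod 4)" "int N = x^2 + y^2" "N > 0"
  shows "even (multiplicity p N)"
  using assms(3,4)
proof (induction N arbitrary: x y rule: less_induct)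
  case (less N)
  show ?case
  proof (cases "p dvd N")
    case False
    then show ?thesis by (simp add: not_dvd_imp_multiplicity_0)
  next
    case True
    then have "int p dvd x^2 + y^2" using less.prems by (metis int_dvd_int_iff)
    then obtain u v where uv: "x = int p * u" "y = int p * v"
      using prime_3_mod_4_dvd_sum_of_squares[OF assms(1,2)] by (metis dvdE)
    have N: "int N = int (p^2) * (u^2 + v^2)" unfolding less.prems uv
      by (simp add: algebra_simps power2_eq_square)
    define M where "M = nat (u^2 + v^2)"
    have M: "int M = u^2 + v^2" by (simp add: M_def)
    have NM: "N = p^2 * M" using N unfolding M [symmetric] by (metis of_nat_eq_iff of_nat_mult)
    have M0: "M > 0" using less.prems(2) unfolding NM by (cases M) auto
    have "p^2 > 1" using prime_gt_1_nat[OF assms(1)] by (rule one_less_power) simp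
    then have "M < N" unfolding NM using M0 by simp
    then have "even (multiplicity p M)" using less.IH M M0 by blast
    moreover have "multiplicity p N = 2 + multiplicity p M"
      unfolding NM using assms(1) M0 prime_gt_0_nat[of p]
      by (subst prime_elem_multiplicity_mult_distrib) auto
    ultimately show ?thesis by simp
  qed
qed

lemma even_cp_3_1_4:
  assumes "prime p" "[p = 3] (mod 4)" "odd (multiplicity p (24 * n + 5))"
  shows "even (cp 3 1 4 n)"
  using assms even_multiplicity_sum_of_squares odd_cp_3_1_4_imp_sum_of_squares
  by (metis add_gr_0 zero_less_numeral)

section \<open>Divergence over the primes congruent to 3 modulo 4\<close>

text \<open>These are the partial sums at 1 of the Dirichlet series of \<open>f\<close>.\<close>

definition recip_sum :: "(nat \<Rightarrow> real) \<Rightarrow> nat \<Rightarrow> real" where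
  "recip_sum f x = (\<Sum>m=1..x. f m / real m)"

lemma recip_sum_split:
  fixes p :: nat
  assumes "p > 0" "\<And>m. m > 0 \<Longrightarrow> f (p * m) = f p * f m"
  shows "recip_sum f x =
      (\<Sum>m | m \<in> {1..x} \<and> \<not> p dvd m. f m / real m) + f p / real p * recip_sum f (x div p)"
proof -
  have "recip_sum f x =
      (\<Sum>m | m \<in> {1..x} \<and> \<not> p dvd m. f m / real m) + (\<Sum>m | m \<in> {1..x} \<and> p dvd m. f m / real m)"
    unfolding recip_sum_def by (subst sum.union_disjoint [symmetric]) (auto intro: sum.cong)
  also have "(\<Sum>m | m \<in> {1..x} \<and> p dvd m. f m / real m) =
      (\<Sum>m=1..x div p. f (p * m) / real (p * m))"
    by (rule sum.reindex_bij_witness [where i = "\<lambda>m. p * m" and j = "\<lambda>m. m div p"])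
       (use assms(1) in \<open>auto simp: div_le_mono less_eq_div_iff_mult_less_eq mult.commute div_greater_zero_iff Suc_le_eq dest: dvd_imp_le\<close>)
  also have "\<dots> = f p / real p * recip_sum f (x div p)"
    unfolding recip_sum_def sum_distrib_left by (intro sum.cong) (auto simp: assms(2))
  finally show ?thesis .
qed

text \<open>The factor comes from the fixed point \<open>C = B + B/p + C/p\<close>, which is
  \<open>B*(p+1)/(p-1)\<close>. Since \<open>- g p\<close> is nonnegative, upper bounds for the sums
  of \<open>g\<close> suffice.\<close>

lemma recip_sum_le_of_twist:
  fixes p :: nat and g h :: "nat \<Rightarrow> real"
  assumes p: "p \<ge> 2" and g: "\<And>m. m > 0 \<Longrightarrow> g (p * m) = g p * g m"
    and h: "\<And>m. m > 0 \<Longrightarrow> h (p * m) = h p * h m"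
    and eq: "\<And>m. m > 0 \<Longrightarrow> \<not> p dvd m \<Longrightarrow> h m = g m"
    and gp: "-1 \<le> g p" "g p \<le> 0" and hp: "h p = 1"
    and bound: "\<And>x. recip_sum g x \<le> B" and B: "B \<ge> 0"
  shows "recip_sum h x \<le> B * ((real p + 1) / (real p - 1))"
proof (induction x rule: less_induct)
  case (less x)
  let ?C = "B * ((real p + 1) / (real p - 1))"
  have C: "?C \<ge> 0" using B p by simp
  show ?case
  proof (cases "x = 0")
    case True
    then show ?thesis using C by (simp add: recip_sum_def)
  next
    case False
    then have "x div p < x" using p by simp
    then have IH: "recip_sum h (x div p) \<le> ?C" by (rule less)
    \<comment> \<open>The functions agree off the multiples of \<open>p\<close>; the multiples contribute rescaled copies of the sums up to \<open>x div p\<close>.\<close>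
    have "(\<Sum>m | m \<in> {1..x} \<and> \<not> p dvd m. h m / real m) =
        (\<Sum>m | m \<in> {1..x} \<and> \<not> p dvd m. g m / real m)"
      by (intro sum.cong) (auto simp: eq)
    then have "recip_sum h x =
        recip_sum g x + (- g p) / real p * recip_sum g (x div p) + recip_sum h (x div p) / real p"
      using recip_sum_split[of p g x] recip_sum_split[of p h x] g h p hp by simp
    also have "\<dots> \<le> B + 1 / real p * B + ?C / real p"
    proof (intro add_mono)
      show "recip_sum h (x div p) / real p \<le> ?C / real p" using IH p
        by (intro divide_right_mono) auto
      have "(- g p) / real p * recip_sum g (x div p) \<le> (- g p) / real p * B"
        using gp p by (intro mult_left_mono bound divide_nonneg_nonneg) auto
      also have "\<dots> \<le> 1 / real p * B"
        using gp p B by (intro mult_right_mono divide_right_mono) auto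
      finally show "(- g p) / real p * recip_sum g (x div p) \<le> 1 / real p * B" .
    qed (rule bound)
    also have "\<dots> = ?C" using p by (simp add: field_simps)
    finally show ?thesis .
  qed
qed

section \<open>The character modulo 4 and its twists\<close>

definition chi4 :: "nat \<Rightarrow> real" where
  "chi4 n = (if n mod 4 = 1 then 1 else if n mod 4 = 3 then -1 else 0)"

lemma chi4_mult: "chi4 (m * n) = chi4 m * chi4 n"
proof -
  have "m mod 4 \<in> {0,1,2,3}" "n mod 4 \<in> {0,1,2,3}" by auto
  moreover have "m * n mod 4 = (m mod 4) * (n mod 4) mod 4" by (simp add: mod_mult_eq)
  ultimately show ?thesis unfolding chi4_def by (elim insertE emptyE) simp_all
qed

lemma recip_sum_chi4_le_1: "recip_sum chi4 x \<le> 1"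
proof -
  have Suc: "recip_sum chi4 (Suc n) = recip_sum chi4 n + chi4 (Suc n) / real (Suc n)" for n
    by (simp add: recip_sum_def)
  have vals: "chi4 (Suc (4*k)) = 1" "chi4 (Suc (Suc (4*k))) = 0" "chi4 (Suc (Suc (Suc (4*k)))) = -1"
    "chi4 (Suc (Suc (Suc (Suc (4*k))))) = 0" for k
    unfolding chi4_def by (simp_all add: mod_Suc)
  \<comment> \<open>The invariant includes the next positive term of 1 - 1/3 + 1/5 - ..., so it
    bounds all partial sums of the block following \<open>4*k\<close>.\<close>
  have main: "recip_sum chi4 (4*k) + 1 / real (4*k+1) \<le> 1" for k
  proof (induction k)
    case 0
    show ?case by (simp add: recip_sum_def)
  next
    case (Suc k)
    have e: "4 * Suc k = Suc (Suc (Suc (Suc (4*k))))" by simp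
    have "recip_sum chi4 (4 * Suc k) = recip_sum chi4 (4*k) + 1 / real (4*k+1) - 1 / real (4*k+3)"
      unfolding e by (simp only: \<open>\<And>n. recip_sum chi4 (Suc n) = _\<close> vals) simp
    moreover have "1 / real (4 * Suc k + 1) \<le> 1 / real (4*k+3)" by (intro divide_left_mono) auto
    ultimately show ?case using Suc by linarith
  qed
  define k where "k = x div 4"
  have "x = 4*k \<or> x = Suc (4*k) \<or> x = Suc (Suc (4*k)) \<or> x = Suc (Suc (Suc (4*k)))"
    unfolding k_def by presburger
  moreover define a u v where "a = recip_sum chi4 (4*k)" and "u = 1 / real (4*k+1)"
    and "v = 1 / real (4*k+3)"
  have "recip_sum chi4 (Suc (4*k)) = a + u" "recip_sum chi4 (Suc (Suc (4*k))) = a + u"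
    "recip_sum chi4 (Suc (Suc (Suc (4*k)))) = a + u - v"
    unfolding a_def u_def v_def by (simp_all add: Suc vals)
  moreover have "a + u \<le> 1" "u \<ge> 0" "v \<ge> 0" using main[of k]
    by (simp_all add: a_def u_def v_def)
  ultimately show ?thesis using a_def by auto
qed

text \<open>Defined through the multiset of prime factors, so that it is completely multiplicative
  on positive numbers and its value can be changed at one prime alone. At 0 it is the empty product
  1.\<close>

definition twist :: "nat set \<Rightarrow> nat \<Rightarrow> real" where
  "twist Q n = (\<Prod>p\<in>#prime_factorization n. if p \<in> Q then 1 else chi4 p)"

lemma twist_mult: "m > 0 \<Longrightarrow> n > 0 \<Longrightarrow> twist Q (m * n) = twist Q m * twist Q n"
  by (simp add: twist_def prime_factorization_mult)

lemma twist_prime: "prime p \<Longrightarrow> twist Q p = (if p \<in> Q then 1 else chi4 p)"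
  by (simp add: twist_def prime_factorization_prime)

lemma twist_empty: "n > 0 \<Longrightarrow> twist {} n = chi4 n"
proof -
  have "(\<Prod>p\<in>#M. chi4 p) = chi4 (\<Prod>\<^sub># M)" for M
    by (induction M) (auto simp: chi4_mult, simp add: chi4_def)
  then show "n > 0 \<Longrightarrow> ?thesis"
    by (simp add: twist_def prod_mset_prime_factorization_nat)
qed

lemma twist_insert: "\<not> p dvd m \<Longrightarrow> twist (insert p Q) m = twist Q m"
  unfolding twist_def
  by (intro arg_cong [where f = prod_mset] image_mset_cong) (auto simp: in_prime_factors_iff)

lemma twist_all: "(\<And>p. prime p \<Longrightarrow> p dvd n \<Longrightarrow>
    chi4 p \<noteq> 1 \<Longrightarrow> p \<in> Q) \<Longrightarrow> twist Q n = 1"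
  unfolding twist_def
  by (rule prod_mset.neutral) (auto simp: in_prime_factors_iff)

text \<open>The primes of \<open>Q\<close> are inserted one by one. Before its insertion,
  \<open>p\<close> has the value \<open>chi4 p\<close>, which is 0 or -1 because it is not
  1.\<close>

lemma recip_sum_twist_le:
  assumes "finite Q" "\<And>p. p \<in> Q \<Longrightarrow> prime p \<and> chi4 p \<noteq> 1"
  shows "recip_sum (twist Q) x \<le> (\<Prod>p\<in>Q. (real p + 1) / (real p - 1))"
  using assms
proof (induction Q arbitrary: x rule: finite_induct)
  case empty
  have "recip_sum (twist {}) x = recip_sum chi4 x"
    unfolding recip_sum_def by (intro sum.cong) (auto simp: twist_empty)
  then show ?case using recip_sum_chi4_le_1 by simp
next
  case (insert p Q)
  have p: "prime p" "chi4 p \<noteq> 1" using insert.prems by auto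
  have "recip_sum (twist (insert p Q)) x \<le>
      (\<Prod>p\<in>Q. (real p + 1) / (real p - 1)) * ((real p + 1) / (real p - 1))"
  proof (rule recip_sum_le_of_twist [where g = "twist Q"])
    show "p \<ge> 2" using p prime_ge_2_nat by blast
    show "recip_sum (twist Q) x \<le> (\<Prod>p\<in>Q. (real p + 1) / (real p - 1))" for x
      using insert by auto
    show "0 \<le> (\<Prod>p\<in>Q. (real p + 1) / (real p - 1))"
      using insert.prems prime_ge_1_nat by (intro prod_nonneg) force
  qed (use p insert.hyps prime_gt_0_nat[of p] in \<open>auto simp: twist_mult twist_prime twist_insert chi4_def\<close>)
  then show ?case using insert.hyps by (simp add: mult.commute)
qed

text \<open>With 2, 3 and the larger primes 3 modulo 4 up to \<open>x\<close> in \<open>Q\<close>,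
  the twist is 1 on all of \<open>{1..x}\<close>. The constant 6 is the product of the factors 3 at
  \<open>p = 2\<close> and 2 at \<open>p = 3\<close>.\<close>

lemma harm_le_prod_primes:
  "harm x \<le> 6 * (\<Prod>p | prime p \<and> [p = 3] (mod 4) \<and> 3 < p \<and> p \<le> x. (real p + 1) / (real p - 1))"
proof -
  let ?f = "\<lambda>p. (real p + 1) / (real p - 1)"
  let ?P = "{p. prime p \<and> [p = 3] (mod 4) \<and> 3 < p \<and> p \<le> x}"
  define Q where "Q = insert 2 (insert 3 ?P)"
  have fin: "finite ?P" by (rule finite_subset[of _ "{..x}"]) auto
  have "harm x = recip_sum (twist Q) x"
  proof -
    have "twist Q m = 1" if "m \<in> {1..x}" for m
    proof (rule twist_all)
      fix p assume p: "prime p" "p dvd m" "chi4 p \<noteq> 1"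
      then have "p \<le> x" using that by (auto dest!: dvd_imp_le)
      moreover have "p \<ge> 2" using p(1) by (rule prime_ge_2_nat)
      moreover have "p = 2 \<or> odd p" using prime_odd_nat[OF p(1)] \<open>p \<ge> 2\<close>
        by (cases "p = 2") auto
      moreover have "p mod 4 \<noteq> 1" using p(3) by (auto simp: chi4_def)
      ultimately have "p \<le> x" "p \<ge> 2" "p = 2 \<or> p mod 4 = 3" by (auto, presburger)
      then show "p \<in> Q" using p(1) by (cases "p = 3") (auto simp: Q_def cong_def)
    qed
    then show ?thesis unfolding harm_def recip_sum_def
      by (intro sum.cong) (auto simp: inverse_eq_divide)
  qed
  also have "\<dots> \<le> (\<Prod>p\<in>Q. ?f p)"
    by (rule recip_sum_twist_le) (use fin in \<open>auto simp: Q_def chi4_def cong_def\<close>)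
  also have "\<dots> = 6 * (\<Prod>p\<in>?P. ?f p)"
    unfolding Q_def using fin by simp
  finally show ?thesis .
qed

text \<open>To first order the cube is \<open>1 - 3/p\<close> and the right side
  \<open>1 - 2/p\<close>. The square agrees to first order but is too large at order
  \<open>1/p^2\<close>.\<close>

lemma local_density_cube_le:
  fixes p :: real
  assumes "p \<ge> 4"
  shows "((p^2 - p + 1) / p^2)^3 \<le> (p - 1) / (p + 1)"
proof -
  have "(p^2 - p + 1)^3 * (p + 1) \<le> (p - 1) * (p^2)^3"
  proof -
    have "(p - 1) * (p^2)^3 - (p^2 - p + 1)^3 * (p + 1) =
        p^5 * (p - 3) + p^2 * (p^2 + p - 3) + (2*p - 1)"
      by (simp add: algebra_simps eval_nat_numeral)
    moreover have "3 \<le> p^2 + p" using assms zero_le_power2[of p] by linarith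
    then have "p^5 * (p - 3) + p^2 * (p^2 + p - 3) + (2*p - 1) \<ge> 0" using assms
      by (intro add_nonneg_nonneg mult_nonneg_nonneg) auto
    ultimately show ?thesis by simp
  qed
  then show ?thesis using assms by (simp add: power_divide divide_simps mult.commute)
qed

lemma prod_local_densities_small:
  fixes \<epsilon> :: real
  assumes "\<epsilon> > 0"
  obtains P :: "nat set" where "finite P" "\<And>p. p \<in> P \<Longrightarrow> prime p \<and> [p = 3] (mod 4) \<and> 3 < p"
    "(\<Prod>p\<in>P. (real p^2 - real p + 1) / real p^2) < \<epsilon>"
proof -
  have "eventually (\<lambda>x. harm x > 6 / \<epsilon>^3) sequentially"
    \<comment> \<open>The 6 cancels the constant in \<open>harm_le_prod_primes\<close>; the cube
      matches \<open>local_density_cube_le\<close>.\<close>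
    using harm_at_top by (simp add: filterlim_at_top_dense)
  then obtain x where x: "harm x > 6 / \<epsilon>^3" by (auto dest: eventually_happens)
  define P where "P = {p. prime p \<and> [p = 3] (mod 4) \<and> 3 < p \<and> p \<le> x}"
  have fin: "finite P" unfolding P_def by (rule finite_subset[of _ "{..x}"]) auto
  define A where "A = (\<Prod>p\<in>P. (real p + 1) / (real p - 1))"
  have "A > 0" unfolding A_def P_def by (intro prod_pos) auto
  have "(\<Prod>p\<in>P. (real p^2 - real p + 1) / real p^2)^3 =
      (\<Prod>p\<in>P. ((real p^2 - real p + 1) / real p^2)^3)"
    by (rule prod_power_distrib)
  also have "\<dots> \<le> (\<Prod>p\<in>P. (real p - 1) / (real p + 1))"
  proof (rule prod_mono, safe)
    fix p assume "p \<in> P"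
    then have p: "real p \<ge> 4" by (auto simp: P_def)
    then show "((real p^2 - real p + 1) / real p^2)^3 \<le> (real p - 1) / (real p + 1)"
      by (rule local_density_cube_le)
    have "real p^2 \<ge> real p * 1" unfolding power2_eq_square using p
      by (intro mult_left_mono) auto
    then show "0 \<le> ((real p^2 - real p + 1) / real p^2)^3" by simp
  qed
  also have "\<dots> = 1 / A"
    unfolding A_def by (simp add: prod_dividef)
  also have "\<dots> < \<epsilon>^3"
  proof -
    have "6 / \<epsilon>^3 < 6 * A" using x harm_le_prod_primes[of x] unfolding A_def P_def by simp
    then show ?thesis using \<open>A > 0\<close> assms by (simp add: field_simps)
  qed
  finally have small: "(\<Prod>p\<in>P. (real p^2 - real p + 1) / real p^2) < \<epsilon>"
    by (rule power_less_imp_less_base) (use assms in simp)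
  show ?thesis
  proof (rule that [OF fin _ small])
    show "prime p \<and> [p = 3] (mod 4) \<and> 3 < p" if "p \<in> P" for p using that
      by (simp add: P_def)
  qed
qed

section \<open>Density\<close>

text \<open>By the Chinese remainder theorem, pairs of residues modulo \<open>M\<close> and
  \<open>N\<close> correspond to residues modulo \<open>M*N\<close>; the hypotheses make
  \<open>A\<close> and \<open>B\<close> unions of residue classes.\<close>

lemma card_periodic_inter:
  fixes A B :: "nat set"
  assumes "coprime M N" "M > 0" "N > 0"
    and A: "\<And>n. n mod M \<in> A \<longleftrightarrow>
        n \<in> A" and B: "\<And>n. n mod N \<in> B \<longleftrightarrow> n \<in> B"
  shows "card (A \<inter> B \<inter> {..<M*N}) =
      card (A \<inter> {..<M}) * card (B \<inter> {..<N})"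
proof -
  let ?f = "\<lambda>n. (n mod M, n mod N)"
  have ex1: "\<exists>!n. n < M*N \<and> [n = u] (mod M) \<and> [n = v] (mod N)" for u v
    using assms by (intro binary_chinese_remainder_unique_nat) auto
  have inj: "inj_on ?f (A \<inter> B \<inter> {..<M*N})"
  proof (rule inj_onI)
    fix m n assume "m \<in> A \<inter> B \<inter> {..<M*N}" "n \<in> A \<inter> B \<inter> {..<M*N}" "?f m = ?f n"
    then show "m = n" using ex1[of n n] by (auto simp: cong_def)
  qed
  have image: "?f ` (A \<inter> B \<inter> {..<M*N}) =
      (A \<inter> {..<M}) \<times> (B \<inter> {..<N})"
  proof
    show "?f ` (A \<inter> B \<inter> {..<M*N}) \<subseteq>
        (A \<inter> {..<M}) \<times> (B \<inter> {..<N})"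
      using assms by auto
    show "(A \<inter> {..<M}) \<times> (B \<inter> {..<N}) \<subseteq>
        ?f ` (A \<inter> B \<inter> {..<M*N})"
    proof safe
      fix u v assume uv: "u \<in> A" "u < M" "v \<in> B" "v < N"
      obtain n where n: "n < M*N" "[n = u] (mod M)" "[n = v] (mod N)" using ex1 by blast
      then have uv': "n mod M = u" "n mod N = v" using uv by (simp_all add: cong_def)
      then have "n \<in> A" "n \<in> B" using uv A[of n] B[of n] by simp_all
      then show "(u, v) \<in> ?f ` (A \<inter> B \<inter> {..<M*N})"
        using n(1) uv' by (intro image_eqI[where x = n]) simp_all
    qed
  qed
  show ?thesis
    unfolding card_image [OF inj, symmetric] image by (rule card_cartesian_product)
qed

text \<open>The numbers up to \<open>n\<close> fit into \<open>n div M + 1\<close> blocks of length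
  \<open>M\<close>, each a translate of the first.\<close>

lemma card_periodic_le:
  fixes A :: "nat set"
  assumes "M > 0" and A: "\<And>n. n mod M \<in> A \<longleftrightarrow> n \<in> A"
  shows "card (A \<inter> {..n}) \<le> (n div M + 1) * card (A \<inter> {..<M})"
proof -
  have blocks: "card (A \<inter> {..<k*M}) \<le> k * card (A \<inter> {..<M})" for k
  proof (induction k)
    case (Suc k)
    have "A \<inter> {..<Suc k*M} \<subseteq>
        (A \<inter> {..<k*M}) \<union> (\<lambda>n. k*M + n) ` (A \<inter> {..<M})"
    proof
      fix n assume n: "n \<in> A \<inter> {..<Suc k*M}"
      show "n \<in> (A \<inter> {..<k*M}) \<union> (\<lambda>n. k*M + n) ` (A \<inter> {..<M})"
      proof (cases "n < k*M")
        case False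
        then have r: "n = k*M + (n - k*M)" "n - k*M < M" using n by auto
        then have "n mod M = n - k*M" by (metis mod_less mod_mult_self3)
        then have "n - k*M \<in> A" using A[of n] n by auto
        then show ?thesis using r by (intro UnI2 image_eqI[where x = "n - k*M"]) auto
      qed (use n in auto)
    qed
    then have "card (A \<inter> {..<Suc k*M}) \<le>
        card ((A \<inter> {..<k*M}) \<union> (\<lambda>n. k*M + n) ` (A \<inter> {..<M}))"
      by (intro card_mono) auto
    also have "\<dots> \<le> card (A \<inter> {..<k*M}) + card ((\<lambda>n. k*M + n) ` (A \<inter> {..<M}))"
      by (rule card_Un_le)
    also have "card ((\<lambda>n. k*M + n) ` (A \<inter> {..<M})) \<le> card (A \<inter> {..<M})"
      by (intro card_image_le) auto
    finally show ?case using Suc by simp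
  qed simp
  have "n < (n div M + 1) * M" using assms(1)
    by (metis add.commute dividend_less_div_times mult.commute plus_1_eq_Suc Suc_eq_plus1 mult_Suc)
  then have "card (A \<inter> {..n}) \<le> card (A \<inter> {..<(n div M + 1) * M})"
    by (intro card_mono) auto
  also note blocks
  finally show ?thesis .
qed

text \<open>Excluding only multiplicity 1, instead of every odd multiplicity, gives a condition that
  is periodic modulo \<open>p^2\<close>.\<close>

definition not_exactly_dividing :: "nat \<Rightarrow> nat set" where
  "not_exactly_dividing p = {n. p dvd 24*n+5 \<longrightarrow> p^2 dvd 24*n+5}"

lemma not_exactly_dividing_mod:
  assumes "p^2 dvd M"
  shows "n mod M \<in> not_exactly_dividing p \<longleftrightarrow> n \<in> not_exactly_dividing p"
proof -
  have "[24 * (n mod M) + 5 = 24 * n + 5] (mod M)"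
    by (intro cong_add cong_mult) (auto simp: cong_def)
  moreover have "p dvd M" using assms by (metis dvd_trans dvd_triv_left power2_eq_square)
  ultimately have "[24 * (n mod M) + 5 = 24 * n + 5] (mod p)" "[24 * (n mod M) + 5 = 24 * n + 5] (mod p^2)"
    using assms cong_dvd_modulus_nat by blast+
  then show ?thesis unfolding not_exactly_dividing_def by (simp add: cong_dvd_iff)
qed

lemma Inter_not_exactly_dividing_mod:
  assumes "finite P"
  shows "n mod (\<Prod>p\<in>P. p^2) \<in> (\<Inter>p\<in>P. not_exactly_dividing p) \<longleftrightarrow>
    n \<in> (\<Inter>p\<in>P. not_exactly_dividing p)"
proof -
  have "p^2 dvd (\<Prod>p\<in>P. p^2)" if "p \<in> P" for p using assms that by (rule dvd_prodI)
  then show ?thesis by (auto simp: not_exactly_dividing_mod)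
qed

text \<open>For \<open>p > 3\<close> the number 24 is invertible modulo \<open>p^2\<close>, so
  \<open>24*n+5\<close> runs through all residues; the excluded ones are the \<open>p - 1\<close>
  nonzero multiples of \<open>p\<close>.\<close>

lemma card_not_exactly_dividing:
  assumes "prime p" "p > 3"
  shows "card (not_exactly_dividing p \<inter> {..<p^2}) = p^2 - (p - 1)"
proof -
  let ?f = "\<lambda>n. (24*n+5) mod p^2"
  let ?S = "{n. n < p^2 \<and> p dvd 24*n+5 \<and> \<not> p^2 dvd 24*n+5}"
  have p0: "p > 0" using assms by simp
  have "coprime p 24"
  proof -
    have "\<not> p dvd 24"
    proof
      assume "p dvd 24"
      then have "p dvd 2 * 2 * 2 * 3" by simp
      then have "p dvd 2 \<or> p dvd 3" using assms(1) by (simp only: prime_dvd_mult_iff) auto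
      then show False using assms(2) by (auto dest: dvd_imp_le)
    qed
    then show ?thesis using assms(1) by (rule prime_imp_coprime [rotated])
  qed
  then have cop: "coprime 24 (p^2)" by (simp add: coprime_commute)
  have inj: "inj_on ?f {..<p^2}"
  proof (rule inj_onI)
    fix m n assume mn: "m \<in> {..<p^2}" "n \<in> {..<p^2}" "?f m = ?f n"
    then have "[24*m+5 = 24*n+5] (mod p^2)" by (simp add: cong_def)
    then have "[m = n] (mod p^2)" using cop
      by (simp add: cong_add_rcancel_nat cong_mult_lcancel_nat)
    then show "m = n" using mn by (simp add: cong_def)
  qed
  have "?f ` {..<p^2} \<subseteq> {..<p^2}" using p0 by auto
  then have surj: "?f ` {..<p^2} = {..<p^2}" using inj by (intro endo_inj_surj) auto
  have pdvd: "p dvd ?f n \<longleftrightarrow> p dvd 24*n+5" for n by (rule dvd_mod_iff) simp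
  have "?f ` ?S = (\<lambda>j. p * j) ` {1..<p}"
  proof
    show "?f ` ?S \<subseteq> (\<lambda>j. p * j) ` {1..<p}"
    proof safe
      fix n assume n: "n < p^2" "p dvd 24*n+5" "\<not> p^2 dvd 24*n+5"
      then obtain j where j: "?f n = p * j" using pdvd by (metis dvdE)
      have "p * j < p * p" using j p0
        by (metis mod_less_divisor power2_eq_square nat_0_less_mult_iff)
      moreover have "j \<noteq> 0" using j n(3) by (metis mod_eq_0_iff_dvd mult_0_right)
      ultimately show "?f n \<in> (\<lambda>j. p * j) ` {1..<p}" using j by auto
    qed
    show "(\<lambda>j. p * j) ` {1..<p} \<subseteq> ?f ` ?S"
    proof safe
      fix j assume j: "j \<in> {1..<p}"
      then have lt: "p * j < p^2" by (simp add: power2_eq_square)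
      then have "p * j \<in> ?f ` {..<p^2}" unfolding surj by simp
      then obtain n where n: "n < p^2" "p * j = ?f n" by (elim imageE) simp
      have "p dvd 24*n+5" unfolding pdvd [symmetric] n(2) [symmetric] by simp
      moreover have "p * j \<noteq> 0" using j by simp
      then have "\<not> p^2 dvd 24*n+5" unfolding n(2) by (simp add: mod_eq_0_iff_dvd)
      ultimately have "n \<in> ?S" using n(1) by simp
      with n(2) show "p * j \<in> ?f ` ?S" by (rule image_eqI)
    qed
  qed
  moreover have "card (?f ` ?S) = card ?S" by (intro card_image inj_on_subset[OF inj]) auto
  moreover have "card ((\<lambda>j. p * j) ` {1..<p}) = p - 1" using p0
    by (subst card_image) (auto simp: inj_on_def)
  ultimately have S: "card ?S = p - 1" by simp
  have "not_exactly_dividing p \<inter> {..<p^2} = {..<p^2} - ?S"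
    by (auto simp: not_exactly_dividing_def)
  moreover have "card ({..<p^2} - ?S) = p^2 - (p - 1)" unfolding S [symmetric]
    by (subst card_Diff_subset) auto
  ultimately show ?thesis by simp
qed

text \<open>The moduli \<open>p^2\<close> are pairwise coprime, so the local counts
  multiply.\<close>

lemma card_Inter_not_exactly_dividing:
  assumes "finite P" "\<And>p. p \<in> P \<Longrightarrow> prime p \<and> 3 < p"
  shows "card ((\<Inter>p\<in>P. not_exactly_dividing p) \<inter> {..<\<Prod>p\<in>P. p^2}) =
      (\<Prod>p\<in>P. p^2 - (p - 1))"
  using assms
proof (induction P rule: finite_induct)
  case empty
  show ?case by simp
next
  case (insert p P)
  let ?M = "\<Prod>p\<in>P. p^2"
  have p: "prime p" "3 < p" using insert.prems by auto
  have "coprime (p^2) ?M"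
    using insert p by (intro prod_coprime_right) (auto intro!: primes_coprime)
  have "(\<Inter>p\<in>insert p P. not_exactly_dividing p) \<inter> {..<\<Prod>p\<in>insert p P. p^2}
      = not_exactly_dividing p \<inter> (\<Inter>p\<in>P. not_exactly_dividing p) \<inter> {..<p^2 * ?M}"
    using insert.hyps by auto
  also have "card \<dots> =
      card (not_exactly_dividing p \<inter> {..<p^2}) * card ((\<Inter>p\<in>P. not_exactly_dividing p) \<inter> {..<?M})"
  proof (rule card_periodic_inter)
    show "?M > 0" using insert.prems prime_gt_0_nat by (intro prod_pos) auto
    show "n mod ?M \<in> (\<Inter>p\<in>P. not_exactly_dividing p) \<longleftrightarrow> n \<in> (\<Inter>p\<in>P. not_exactly_dividing p)"
      for n
      using insert.hyps(1) by (rule Inter_not_exactly_dividing_mod)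
  qed (use p \<open>coprime (p^2) ?M\<close> in \<open>auto simp: not_exactly_dividing_mod\<close>)
  also have "\<dots> = (p^2 - (p - 1)) * (\<Prod>p\<in>P. p^2 - (p - 1))"
    using insert p by (simp add: card_not_exactly_dividing)
  finally show ?case using insert.hyps by simp
qed

section \<open>Odd values have density zero\<close>

lemma odd_cp_3_1_4_imp_not_exactly_dividing:
  assumes "prime p" "[p = 3] (mod 4)" "odd (cp 3 1 4 n)"
  shows "n \<in> not_exactly_dividing p"
proof (rule ccontr)
  assume "n \<notin> not_exactly_dividing p"
  then have "p^1 dvd 24*n+5" "\<not> p^Suc 1 dvd 24*n+5"
    by (auto simp: not_exactly_dividing_def power2_eq_square)
  then have "multiplicity p (24*n+5) = 1" by (rule multiplicity_eqI)
  then have "even (cp 3 1 4 n)" using even_cp_3_1_4[OF assms(1,2)] by simp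
  then show False using assms(3) by simp
qed

lemma odd_cp_3_1_4_density_zero:
  "(\<lambda>n. real (card {k. 1 \<le> k \<and> k \<le> n \<and> odd (cp 3 1 4 k)}) / real n) \<longlonglongrightarrow> 0"
proof (rule LIMSEQ_I)
  fix r :: real assume r: "r > 0"
  then obtain P :: "nat set" where P: "finite P" "\<And>p. p \<in> P \<Longrightarrow>
      prime p \<and> [p = 3] (mod 4) \<and> 3 < p"
    and small: "(\<Prod>p\<in>P. (real p^2 - real p + 1) / real p^2) < r / 2"
    using prod_local_densities_small[of "r / 2"] by auto
  define M where "M = (\<Prod>p\<in>P. p^2)"
  define A where "A = (\<Inter>p\<in>P. not_exactly_dividing p)"
  define D where "D = card (A \<inter> {..<M})"
  have M: "M > 0" unfolding M_def using P prime_gt_0_nat by (intro prod_pos) auto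
  have "D = (\<Prod>p\<in>P. p^2 - (p - 1))"
    unfolding D_def A_def M_def using P by (intro card_Inter_not_exactly_dividing) auto
  moreover have "real (p^2 - (p - 1)) = real p^2 - real p + 1" if "p \<in> P" for p
  proof -
    have "p - 1 \<le> p^2" using self_le_power[of p 2] P(2)[OF that] by linarith
    then show ?thesis using P(2)[OF that] by (simp add: of_nat_diff)
  qed
  ultimately have "real D / real M = (\<Prod>p\<in>P. (real p^2 - real p + 1) / real p^2)"
    unfolding M_def by (simp add: prod_dividef)
  then have density: "real D / real M < r / 2" using small by simp
  have periodic: "n mod M \<in> A \<longleftrightarrow> n \<in> A" for n
    unfolding A_def M_def using P(1) by (rule Inter_not_exactly_dividing_mod)
  \<comment> \<open>The additive \<open>D\<close> pays for the last, possibly incomplete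
    period.\<close>
  have count: "real (card {k. 1 \<le> k \<and> k \<le> n \<and> odd (cp 3 1 4 k)}) \<le> real n * (real D / real M) + real D"
    for n
  proof -
    have "card {k. 1 \<le> k \<and> k \<le> n \<and> odd (cp 3 1 4 k)} \<le>
        card (A \<inter> {..n})"
      using P(2) odd_cp_3_1_4_imp_not_exactly_dividing by (intro card_mono) (auto simp: A_def)
    also have "\<dots> \<le> (n div M + 1) * D"
      unfolding D_def using M periodic by (rule card_periodic_le)
    finally have "real (card {k. 1 \<le> k \<and> k \<le> n \<and> odd (cp 3 1 4 k)}) \<le>
        (real (n div M) + 1) * real D"
      by (metis of_nat_1 of_nat_add of_nat_le_iff of_nat_mult)
    also have "\<dots> \<le> (real n / real M + 1) * real D"
      by (intro mult_right_mono add_right_mono of_nat_div_le_of_nat) simp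
    finally show ?thesis by (simp add: algebra_simps)
  qed
  \<comment> \<open>Beyond this bound the additive \<open>D\<close> is less than
    \<open>n * r / 2\<close>, and the density term is below the other half.\<close>
  obtain n0 :: nat where n0: "real n0 > 2 * real D / r" using reals_Archimedean2 by blast
  show "\<exists>no. \<forall>n\<ge>no. norm (real (card {k. 1 \<le> k \<and> k \<le> n \<and> odd (cp 3 1 4 k)}) / real n - 0) < r"
  proof (intro exI allI impI)
    fix n assume n: "n \<ge> Suc n0"
    then have n': "real n > 0" "real n > 2 * real D / r" using n0 by auto
    have "real D < real n * (r / 2)" using n'(2) r by (simp add: field_simps)
    moreover have "real n * (real D / real M) < real n * (r / 2)"
      using n'(1) density by (intro mult_strict_left_mono)
    moreover have "real n * (r / 2) + real n * (r / 2) = real n * r" by simp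
    ultimately have "real (card {k. 1 \<le> k \<and> k \<le> n \<and> odd (cp 3 1 4 k)}) < real n * r"
      using count[of n] by linarith
    then show "norm (real (card {k. 1 \<le> k \<and> k \<le> n \<and> odd (cp 3 1 4 k)}) / real n - 0) < r"
      using n'(1) by (simp add: divide_simps mult.commute)
  qed
qed

theorem theorem4p5:
  "(\<lambda>n. real (card {k. 1 \<le> k \<and> k \<le> n \<and> even (cp 3 1 4 k)}) / real n) \<longlonglongrightarrow> 1 \<and>
   (\<forall>n::nat. (\<exists>p::nat. prime p \<and> [p = 3] (mod 4) \<and> odd (multiplicity p (24 * n + 5)))
      \<longrightarrow> even (cp 3 1 4 n))"
proof
  let ?o = "\<lambda>n. real (card {k. 1 \<le> k \<and> k \<le> n \<and> odd (cp 3 1 4 k)}) / real n"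
  let ?e = "\<lambda>n. real (card {k. 1 \<le> k \<and> k \<le> n \<and> even (cp 3 1 4 k)}) / real n"
  \<comment> \<open>At \<open>n = 0\<close> both quotients are 0 by the convention for division, so
    the identity is used only eventually.\<close>
  have eq: "1 - ?o n = ?e n" if "n > 0" for n
  proof -
    let ?O = "{k. 1 \<le> k \<and> k \<le> n \<and> odd (cp 3 1 4 k)}" and ?E = "{k. 1 \<le> k \<and> k \<le> n \<and> even (cp 3 1 4 k)}"
    have "card (?O \<union> ?E) = card ?O + card ?E"
      by (rule card_Un_disjoint) auto
    moreover have "?O \<union> ?E = {1..n}" by auto
    ultimately have "real n = real (card ?O) + real (card ?E)" by simp
    then show ?thesis using that by (simp add: field_simps)
  qed
  have "eventually (\<lambda>n. 1 - ?o n = ?e n) sequentially"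
    by (rule eventually_mono [OF eventually_gt_at_top [of 0]]) (rule eq)
  moreover have "(\<lambda>n. 1 - ?o n) \<longlonglongrightarrow> 1 - 0"
    by (intro tendsto_diff tendsto_const odd_cp_3_1_4_density_zero)
  ultimately show "?e \<longlonglongrightarrow> 1" by (auto intro: Lim_transform_eventually)
  show "\<forall>n::nat. (\<exists>p::nat. prime p \<and> [p = 3] (mod 4) \<and> odd (multiplicity p (24 * n + 5)))
      \<longrightarrow> even (cp 3 1 4 n)"
    using even_cp_3_1_4 by blast
qed

end
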